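(* Let $p$ be a prime and $R$ a finite ring such that $|R|$ is a power of $p$. Then for every integer $k\ge1$, $$|\mathcal{I}_{k+1}(R)|\le \frac{k+1}{p}\,|R|^{\frac{2k}{k+1}},$$ where $\mathcal{I}_{k+1}(R)=\{x\in R: x^{k+1}=x\}$ is the set of $(k+1)$-potent elements of $R$.
   Formalization: The order |R| is taken to be p^n with n ≥ 1, so the zero ring is excluded; for it the bound fails, e.g. p = 3, k = 1 would give 1 ≤ 2/3. *)

theory Defs
  imports Complex_Main "HOL-Computational_Algebra.Primes" "HOL-Library.Cardinality"
begin

text \<open>
  The class \<^class>\<open>ring\<close> consists of associative rings, neither commutative nor unital in general,
  so the overloaded power operation is not available. The following is the power
  \<open>x * \<dots> * x\<close> with \<open>n\<close> factors, meant for \<open>n \<ge> 1\<close>.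
\<close>

definition pos_power :: "'a::semigroup_mult \<Rightarrow> nat \<Rightarrow> 'a"
  where "pos_power x n = ((*) x ^^ (n - 1)) x"

lemma pos_power_1: "pos_power x 1 = x"
  by (simp add: pos_power_def)

lemma pos_power_Suc: "n \<ge> 1 \<Longrightarrow> pos_power x (Suc n) = x * pos_power x n"
  by (cases n) (simp_all add: pos_power_def)

lemma pos_power_eq_power:
  fixes x :: "'a::monoid_mult"
  shows "n \<ge> 1 \<Longrightarrow> pos_power x n = x ^ n"
  by (induction n rule: dec_induct) (simp_all add: pos_power_1[simplified] pos_power_Suc)

definition potents :: "nat \<Rightarrow> 'a::ring set"
  where "potents n = {x. pos_power x n = x}"

end

theory Submission
  imports Defs
begin

text \<open>
  Since \<open>2k / (k + 1) \<ge> 1\<close>, it suffices to show \<open>p |I| \<le> (k + 1) |R|\<close> for the set \<open>I\<close> of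
  \<open>(k + 1)\<close>-potents. If \<open>I = {0}\<close> this is clear. Otherwise fix \<open>y \<noteq> 0\<close> in \<open>I\<close>. On each line
  \<open>{x + t y | 0 \<le> t < p}\<close> the potents are the zeros of a polynomial in the integer \<open>t\<close> with
  coefficients in \<open>R\<close>, of degree \<open>k + 1\<close> and leading coefficient \<open>y\<^sup>k\<^sup>+\<^sup>1 = y \<noteq> 0\<close>. Differences of
  distinct values of \<open>t\<close> are prime to \<open>p\<close>, hence act injectively on the \<open>p\<close>-group \<open>R\<close>, so there are
  at most \<open>k + 1\<close> zeros. Averaging over all \<open>x\<close> gives the bound.
\<close>

section \<open>Integer multiples in abelian groups\<close>

text \<open>Without a unit there is no \<open>of_int\<close>, so multiples are repeated sums. Since
  \<open>nat\<close> sends negative integers to 0, at most one of the two sums is nonempty.\<close>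

definition int_mult :: "int \<Rightarrow> 'a::ab_group_add \<Rightarrow> 'a"
  where "int_mult m a = (\<Sum>i<nat m. a) - (\<Sum>i<nat (- m). a)"

lemma int_mult_0 [simp]: "int_mult 0 a = 0"
  by (simp add: int_mult_def)

lemma int_mult_1 [simp]: "int_mult 1 a = a"
  by (simp add: int_mult_def)

lemma int_mult_plus_1: "int_mult (m + 1) a = int_mult m a + a"
proof (cases "m \<ge> 0")
  case True
  then have "nat (m + 1) = Suc (nat m)" "nat (- m) = 0" "nat (- (m + 1)) = 0" by auto
  then show ?thesis by (simp add: int_mult_def)
next
  case False
  then have "nat (- m) = Suc (nat (- (m + 1)))" "nat m = 0" "nat (m + 1) = 0" by auto
  then show ?thesis by (simp add: int_mult_def)
qed

lemma int_mult_minus_1: "int_mult (m - 1) a = int_mult m a - a"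
  using int_mult_plus_1[of "m - 1" a] by (simp add: algebra_simps)

lemma int_mult_add_left: "int_mult (m + n) a = int_mult m a + int_mult n a"
proof (induction n rule: int_induct[where k = 0])
  case base
  show ?case by simp
next
  case (step1 i)
  then show ?case
    using int_mult_plus_1[of "m + i" a] by (simp add: int_mult_plus_1 add.assoc)
next
  case (step2 i)
  then show ?case
    using int_mult_minus_1[of "m + i" a] by (simp add: int_mult_minus_1 add_diff_eq)
qed

lemma int_mult_diff_left: "int_mult (m - n) a = int_mult m a - int_mult n a"
  using int_mult_add_left[of "m - n" n a] by simp

lemma int_mult_mult: "int_mult (m * n) a = int_mult m (int_mult n a)"
  by (induction m rule: int_induct[where k = 0])
    (simp_all add: distrib_right left_diff_distrib int_mult_add_left int_mult_diff_left)

lemma additive_int_mult: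
  assumes "additive h"
  shows "h (int_mult m a) = int_mult m (h a)"
  by (simp add: int_mult_def additive.diff[OF assms] additive.sum[OF assms])

lemma int_mult_additive: "additive (int_mult m)"
  by standard (simp add: int_mult_def sum.distrib)

text \<open>Translation by \<open>a\<close> permutes the group, so the sum of all elements does not
  change when \<open>a\<close> is added to each of them.\<close>

lemma int_mult_card_UNIV: "int_mult (int CARD('a)) (a :: 'a::{finite,ab_group_add}) = 0"
proof -
  obtain f :: "nat \<Rightarrow> 'a" where f: "bij_betw f {..<CARD('a)} UNIV"
    using ex_bij_betw_nat_finite[of "UNIV :: 'a set"] by (auto simp: atLeast0LessThan)
  have "int_mult (int CARD('a)) a = (\<Sum>x\<in>(UNIV :: 'a set). a)"
    using sum.reindex_bij_betw[OF f, of "\<lambda>_. a"] by (simp add: int_mult_def)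
  moreover have "(\<Sum>x\<in>(UNIV :: 'a set). x + a) = (\<Sum>x\<in>UNIV. x)"
    by (rule sum.reindex_bij_witness[of _ "\<lambda>x. x - a" "\<lambda>x. x + a"]) auto
  ultimately show ?thesis by (simp add: sum.distrib)
qed

text \<open>By Bezout, 1 is a combination of \<open>m\<close> and the group order, and both
  annihilate \<open>a\<close>.\<close>

lemma int_mult_eq_0_coprime:
  fixes a :: "'a::{finite,ab_group_add}"
  assumes "coprime m (int CARD('a))" and "int_mult m a = 0"
  shows "a = 0"
proof -
  obtain u v where "u * m + v * int CARD('a) = 1"
    using bezout_int[of m "int CARD('a)"] assms(1) by (auto simp: coprime_iff_gcd_eq_1)
  then have "a = int_mult (u * m + v * int CARD('a)) a" by simp
  also have "\<dots> = 0"
    by (simp only: int_mult_add_left int_mult_mult assms(2) int_mult_card_UNIV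
        additive.zero[OF int_mult_additive] add_0)
  finally show ?thesis .
qed

section \<open>Polynomial maps from the integers to an abelian group\<close>

text \<open>
  \<open>poly_map d c f\<close> means that \<open>f\<close> is polynomial of degree at most \<open>d\<close> and that \<open>c\<close> is its coefficient
  of degree \<open>d\<close>. It is phrased through divided differences because that is what root counting needs.
\<close>

primrec poly_map :: "nat \<Rightarrow> 'a::ab_group_add \<Rightarrow> (int \<Rightarrow> 'a) \<Rightarrow> bool" where
  "poly_map 0 c f \<longleftrightarrow> (\<forall>t. f t = c)"
| "poly_map (Suc d) c f \<longleftrightarrow>
    (\<forall>s. \<exists>g. poly_map d c g \<and> (\<forall>t. f t - f s = int_mult (t - s) (g t)))"

lemma poly_map_add:
  assumes "poly_map d b f" and "poly_map d c g"
  shows "poly_map d (b + c) (\<lambda>t. f t + g t)"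
  using assms
proof (induction d arbitrary: f g)
  case 0
  then show ?case by simp
next
  case (Suc d)
  show ?case unfolding poly_map.simps
  proof
    fix s
    obtain f' where f': "poly_map d b f'" "\<And>t. f t - f s = int_mult (t - s) (f' t)"
      using Suc.prems(1) by (auto simp only: poly_map.simps)
    obtain g' where g': "poly_map d c g'" "\<And>t. g t - g s = int_mult (t - s) (g' t)"
      using Suc.prems(2) by (auto simp only: poly_map.simps)
    have "(f t + g t) - (f s + g s) = int_mult (t - s) (f' t + g' t)" for t
      by (simp add: additive.add[OF int_mult_additive] f'(2)[symmetric] g'(2)[symmetric])
    then show "\<exists>h. poly_map d (b + c) h \<and> (\<forall>t. (f t + g t) - (f s + g s) = int_mult (t - s) (h t))"
      using Suc.IH[OF f'(1) g'(1)] by blast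
  qed
qed

lemma poly_map_compose_additive:
  assumes h: "additive h" and "poly_map d c f"
  shows "poly_map d (h c) (\<lambda>t. h (f t))"
  using assms(2)
proof (induction d arbitrary: f)
  case 0
  then show ?case by simp
next
  case (Suc d)
  show ?case unfolding poly_map.simps
  proof
    fix s
    obtain g where g: "poly_map d c g" "\<And>t. f t - f s = int_mult (t - s) (g t)"
      using Suc.prems by (auto simp only: poly_map.simps)
    have "h (f t) - h (f s) = int_mult (t - s) (h (g t))" for t
      by (simp add: additive.diff[OF h, symmetric] g(2) additive_int_mult[OF h])
    then show "\<exists>g. poly_map d (h c) g \<and> (\<forall>t. h (f t) - h (f s) = int_mult (t - s) (g t))"
      using Suc.IH[OF g(1)] by blast
  qed
qed

text \<open>The degree in \<open>poly_map\<close> is only an upper bound. Raising it lets terms of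
  lower degree be added without changing the leading coefficient.\<close>

lemma poly_map_Suc_0:
  assumes "poly_map d c f"
  shows "poly_map (Suc d) 0 f"
  using assms
proof (induction d arbitrary: f)
  case 0
  then show ?case
    by (auto intro!: exI[of _ "\<lambda>_. 0"] simp: additive.zero[OF int_mult_additive])
next
  case (Suc d)
  then show ?case unfolding poly_map.simps(2)[of "Suc d"] poly_map.simps(2)[of d c] by blast
qed

lemma poly_map_mono_0:
  assumes "poly_map d c f" and "d < e"
  shows "poly_map e 0 f"
  using assms(2)
proof (induction e)
  case 0
  then show ?case by simp
next
  case (Suc e)
  then show ?case using assms(1) poly_map_Suc_0 by (metis less_Suc_eq)
qed

text \<open>Product rule: t f(t) - s f(s) = (t - s) f(t) + s (f(t) - f(s)), so the divided
  difference is f + s g, where g is that of f.\<close>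

lemma poly_map_times_arg:
  assumes "poly_map d c f"
  shows "poly_map (Suc d) c (\<lambda>t. int_mult t (f t))"
proof -
  have "\<exists>h. poly_map d c h \<and> (\<forall>t. int_mult t (f t) - int_mult s (f s) = int_mult (t - s) (h t))"
    for s
  proof (cases d)
    case 0
    then have "f t = c" for t using assms by simp
    then show ?thesis using assms by (auto intro!: exI[of _ f] simp: int_mult_diff_left)
  next
    case (Suc e)
    then obtain g where g: "poly_map e c g" "\<And>t. f t - f s = int_mult (t - s) (g t)"
      using assms by (auto simp only: poly_map.simps)
    \<comment> \<open>The degree of \<open>g\<close> is at most \<open>e = d - 1\<close>, so
      \<open>g\<close> contributes 0 in degree \<open>d\<close>.\<close>
    have "poly_map d (c + 0) (\<lambda>t. f t + int_mult s (g t))"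
      using poly_map_add[OF assms, unfolded Suc]
        poly_map_Suc_0[OF poly_map_compose_additive[OF int_mult_additive g(1)]] Suc
      by blast
    moreover have "int_mult t (f t) - int_mult s (f s)
        = int_mult (t - s) (f t + int_mult s (g t))" for t
    proof -
      have "int_mult t (f t) - int_mult s (f s) = int_mult (t - s) (f t) + int_mult s (f t - f s)"
        by (simp add: int_mult_diff_left additive.diff[OF int_mult_additive])
      also have "int_mult s (f t - f s) = int_mult (t - s) (int_mult s (g t))"
        by (simp add: g(2) int_mult_mult[symmetric] mult.commute)
      finally show ?thesis by (simp add: additive.add[OF int_mult_additive])
    qed
    ultimately show ?thesis by auto
  qed
  then show ?thesis by simp
qed

text \<open>Split off one root s: at any other root t, (t - s) g(t) = 0, and t - s acts injectively,
  so the divided difference g vanishes on the remaining points and has the same leading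
  coefficient.\<close>

lemma poly_map_leading_coeff_0:
  fixes c :: "'a::{finite,ab_group_add}"
  assumes "poly_map d c f" and "finite S" and "d < card S"
    and "\<And>t. t \<in> S \<Longrightarrow> f t = 0"
    and "\<And>s t. s \<in> S \<Longrightarrow> t \<in> S \<Longrightarrow> s \<noteq> t \<Longrightarrow> coprime (t - s) (int CARD('a))"
  shows "c = 0"
  using assms
proof (induction d arbitrary: f S)
  case 0
  then obtain s where "s \<in> S" by fastforce
  then show ?case using "0.prems"(1,4) by simp
next
  case (Suc d)
  then obtain s where s: "s \<in> S" by fastforce
  obtain g where g: "poly_map d c g" "\<And>t. f t - f s = int_mult (t - s) (g t)"
    using Suc.prems(1) by (auto simp only: poly_map.simps)
  show ?case
  proof (rule Suc.IH[OF g(1), of "S - {s}"])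
    fix t assume t: "t \<in> S - {s}"
    then have "int_mult (t - s) (g t) = 0" using g(2)[of t] s Suc.prems(4) by simp
    then show "g t = 0" using int_mult_eq_0_coprime Suc.prems(5)[OF s, of t] t by blast
  qed (use Suc.prems s in \<open>auto simp: card_Diff_singleton\<close>)
qed

section \<open>Potents on a line\<close>

text \<open>Peel off the left factor x + t y. Only the integer t has to commute with ring elements,
  so x and y need not commute.\<close>

lemma poly_map_pos_power:
  fixes x y :: "'a::ring"
  assumes "m \<ge> 1"
  shows "poly_map m (pos_power y m) (\<lambda>t. pos_power (x + int_mult t y) m)"
  using assms
proof (induction m rule: dec_induct)
  case base
  have "x + int_mult t y - (x + int_mult s y) = int_mult (t - s) y" for s t
    by (simp add: int_mult_diff_left)
  then show ?case by (auto intro!: exI[of _ "\<lambda>_. y"] simp: pos_power_1[simplified])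
next
  case (step m)
  let ?f = "\<lambda>t. pos_power (x + int_mult t y) m"
  have left: "additive ((*) z)" for z :: 'a by standard (simp add: distrib_left)
  have right: "additive (\<lambda>w. w * z)" for z :: 'a by standard (simp add: distrib_right)
  have "poly_map (Suc m) (0 + y * pos_power y m) (\<lambda>t. x * ?f t + int_mult t (y * ?f t))"
    by (intro poly_map_add poly_map_Suc_0[OF poly_map_compose_additive[OF left step.IH]]
        poly_map_times_arg[OF poly_map_compose_additive[OF left step.IH]])
  then show ?case
    using step.hyps additive_int_mult[OF right, of _ y]
    by (simp only: pos_power_Suc distrib_right add_0)
qed

lemma card_potents_on_line:
  fixes x y :: "'a::{finite,ring}"
  assumes "prime p" and "CARD('a) = p ^ n" and "k \<ge> 1"
    and y: "pos_power y (k + 1) \<noteq> 0"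
  shows "card {t \<in> {0..<int p}. x + int_mult t y \<in> potents (k + 1)} \<le> k + 1"
    (is "card ?S \<le> _")
proof (rule ccontr)
  assume *: "\<not> card ?S \<le> k + 1"
  let ?f = "\<lambda>t. pos_power (x + int_mult t y) (k + 1) + - (x + int_mult t y)"
  have line: "poly_map 1 y (\<lambda>t. x + int_mult t y)"
    using poly_map_pos_power[of 1 y x] by (simp only: pos_power_1)
  have uminus: "additive (uminus :: 'a \<Rightarrow> 'a)" by standard simp
  have "poly_map 1 (- y) (\<lambda>t. - (x + int_mult t y))"
    by (rule poly_map_compose_additive[OF uminus line])
  \<comment> \<open>As \<open>k \<ge> 1\<close>, the linear term lies below degree
    \<open>k + 1\<close> and leaves the leading coefficient alone.\<close>
  then have "poly_map (k + 1) 0 (\<lambda>t. - (x + int_mult t y))"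
    by (rule poly_map_mono_0) (use \<open>k \<ge> 1\<close> in simp)
  then have "poly_map (k + 1) (pos_power y (k + 1) + 0) ?f"
    by (rule poly_map_add[OF poly_map_pos_power, rotated]) simp
  then have "pos_power y (k + 1) + 0 = 0"
  proof (rule poly_map_leading_coeff_0)
    show "finite ?S" by (rule finite_subset[of _ "{0..<int p}"]) auto
    show "k + 1 < card ?S" using * by simp
    show "?f t = 0" if "t \<in> ?S" for t using that by (simp add: potents_def)
    show "coprime (t - s) (int CARD('a))" if "s \<in> ?S" "t \<in> ?S" "s \<noteq> t" for s t
    proof -
      \<comment> \<open>Two distinct integers in [0, p) differ by less than p in absolute
        value.\<close>
      have "\<not> int p dvd t - s"
        using that zdvd_imp_le[of "int p" "t - s"] zdvd_imp_le[of "int p" "s - t"]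
        by (cases "s < t") (auto simp: dvd_diff_commute[of _ t s])
      then have "coprime (int p) (t - s)"
        using \<open>prime p\<close> by (intro prime_imp_coprime) auto
      then show ?thesis using assms(2) by (simp add: coprime_commute)
    qed
  qed
  then show False using y by simp
qed

lemma card_potents_le:
  assumes "prime p" and card: "CARD('a::{finite,ring}) = p ^ n" and "n \<ge> 1" and "k \<ge> 1"
  shows "p * card (potents (k + 1) :: 'a set) \<le> (k + 1) * CARD('a)"
proof (cases "\<exists>y \<in> potents (k + 1). y \<noteq> (0 :: 'a)")
  case False
  then have "potents (k + 1) \<subseteq> {0 :: 'a}" by auto
  then have "card (potents (k + 1) :: 'a set) \<le> 1"
    using card_mono[of "{0 :: 'a}"] by fastforce
  moreover have "p \<le> CARD('a)"
    using card \<open>n \<ge> 1\<close> prime_gt_0_nat[OF \<open>prime p\<close>] self_le_power[of p n] by simp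
  ultimately have "p * card (potents (k + 1) :: 'a set) \<le> CARD('a) * 1"
    by (intro mult_mono) auto
  then show ?thesis by simp
next
  case True
  then obtain y :: 'a where "y \<in> potents (k + 1)" "y \<noteq> 0" by blast
  then have y: "pos_power y (k + 1) \<noteq> 0" by (simp add: potents_def)
  let ?I = "potents (k + 1) :: 'a set"
  let ?T = "{0..<int p}"
  \<comment> \<open>For fixed \<open>t\<close>, translation by t y is a bijection, so each
    \<open>t\<close> accounts for exactly \<open>card ?I\<close> pairs (x, t) with x + t y
    potent.\<close>
  have "card {x. x + int_mult t y \<in> ?I} = card ?I" for t
    by (rule bij_betw_same_card[of "\<lambda>x. x + int_mult t y"],
        rule bij_betw_byWitness[where f' = "\<lambda>x. x - int_mult t y"]) auto
  then have "p * card ?I = (\<Sum>t\<in>?T. card {x\<in>UNIV. x + int_mult t y \<in> ?I})" by simp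
  \<comment> \<open>Count the same pairs by \<open>x\<close> instead: each line contributes at most
    \<open>k + 1\<close>.\<close>
  also have "\<dots> = (\<Sum>x\<in>UNIV. card {t\<in>?T. x + int_mult t y \<in> ?I})"
    by (rule sum_multicount_gen[symmetric]) auto
  also have "\<dots> \<le> (\<Sum>x\<in>(UNIV :: 'a set). k + 1)"
    by (intro sum_mono card_potents_on_line[OF assms(1,2,4) y])
  finally show ?thesis by (simp add: mult.commute)
qed

theorem theorem2:
  fixes p n k :: nat
  assumes "prime p"
    and "CARD('a::{finite,ring}) = p ^ n" and "n \<ge> 1"
    and "k \<ge> 1"
  shows "real (card (potents (k + 1) :: 'a set))
    \<le> real (k + 1) / real p * real CARD('a) powr (2 * real k / real (k + 1))"
proof -
  have "real (p * card (potents (k + 1) :: 'a set)) \<le> real ((k + 1) * CARD('a))"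
    using card_potents_le[OF assms] by (intro of_nat_mono)
  then have "real (card (potents (k + 1) :: 'a set)) \<le> real (k + 1) / real p * real CARD('a)"
    using prime_gt_0_nat[OF \<open>prime p\<close>] by (simp add: field_simps)
  also have "\<dots> \<le> real (k + 1) / real p * real CARD('a) powr (2 * real k / real (k + 1))"
  proof (rule mult_left_mono)
    have "real CARD('a) \<ge> 1" by (simp add: Suc_le_eq)
    moreover have "1 \<le> 2 * real k / real (k + 1)" using \<open>k \<ge> 1\<close> by (simp add: field_simps)
    ultimately have "real CARD('a) powr 1 \<le> real CARD('a) powr (2 * real k / real (k + 1))"
      by (intro powr_mono)
    then show "real CARD('a) \<le> real CARD('a) powr (2 * real k / real (k + 1))" by simp
  qed simp
  finally show ?thesis .
qed

end
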